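(* Let $\delta\ge 0$ and $\lambda>0$, and assume (A1)--(A4). Then both the problem $$\inf_{\phi\in K}\ \sup_{\mathcal{R}\in\mathbb{L}_1} J_1(\mathcal{G}_\phi,\mathcal{R}\,|\,\lambda,\pi_{y^\delta}) \qquad (\mathrm{P1})$$ and the problem $$\inf_{\phi\in K} J_2(\mathcal{G}_\phi\,|\,\lambda,\pi_{y^\delta}) \qquad (\mathrm{P2})$$ admit an optimal solution, and $$\inf_{\phi\in K}\ \sup_{\mathcal{R}\in\mathbb{L}_1} J_1(\mathcal{G}_\phi,\mathcal{R}\,|\,\lambda,\pi_{y^\delta})=\inf_{\phi\in K} J_2(\mathcal{G}_\phi\,|\,\lambda,\pi_{y^\delta}).$$ Moreover, if $(\mathcal{G}_{\phi^*},\mathcal{R}^* )$ is optimal for (P1), then $\mathcal{G}_{\phi^*}$ is optimal for (P2). Conversely, if $\mathcal{G}_{\phi^*}$ is optimal for (P2), then $(\mathcal{G}_{\phi^*},\mathcal{R}^* )$ is optimal for (P1) for every $$\mathcal{R}^*\in\operatorname*{arg\,max}_{\mathcal{R}\in\mathbb{L}_1}\ \mathbb{E}_{\pi_{y^\delta}}\left[\mathcal{R}(\mathcal{G}_{\phi^*}(y^\delta))\right]-\mathbb{E}_{\pi_x}\left[\mathcal{R}(x)\right].$$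
   Context: Setting: $\mathcal{A}:\mathbb{R}^n\to\mathbb{R}^k$ is a linear operator. $\pi_x$ is a (Borel) probability measure on $\mathbb{R}^n$ and, for each $\delta\ge 0$, $\pi_{y^\delta}$ is a (Borel) probability measure on $\mathbb{R}^k$. The expectation $\mathbb{E}_{\pi_{y^\delta}}$ is over $y^\delta\sim\pi_{y^\delta}$ and $\mathbb{E}_{\pi_x}$ is over $x\sim\pi_x$. $\{\mathcal{G}_\phi\}_{\phi}$ is a family of measurable maps $\mathcal{G}_\phi:\mathbb{R}^k\to\mathbb{R}^n$. Assumptions: (A1) $\pi_x$ is compactly supported, and there is a compact set $\mathcal{K}\subset\mathbb{R}^k$ such that $\pi_{y^\delta}$ is supported on $\mathcal{K}$ for every $\delta\ge0$. (A2) The parameter $\phi$ ranges over a (nonempty) compact subset $K$ of a finite-dimensional space. (A3) $\mathcal{G}_{\phi_n}\to\mathcal{G}_\phi$ pointwise whenever $\phi_n\to\phi$ in $K$. (A4) $\sup_{\phi\in K}\|\mathcal{G}_\phi\|_\infty<\infty$, where $\|\cdot\|_\infty$ is the supremum norm. Notation: $\mathbb{L}_1$ is the set of all $1$-Lipschitz functions $\mathcal{R}:\mathbb{R}^n\to\mathbb{R}$ (w.r.t. the Euclidean norm). $T_\#\pi$ denotes the push-forward of $\pi$ by $T$. $\mathbb{W}_1(\pi_1,\pi_2)=\inf_{\mu\in\Pi(\pi_1,\pi_2)}\int\|x_1-x_2\|_2\,\mathrm{d}\mu(x_1,x_2)$ is the Wasserstein-1 distance, where $\Pi(\pi_1,\pi_2)$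 is the set of couplings of $\pi_1$ and $\pi_2$. $$J_1(\mathcal{G}_\phi,\mathcal{R}|\lambda,\pi_{y^\delta}):=\mathbb{E}_{\pi_{y^\delta}}\|y^\delta-\mathcal{A}\mathcal{G}_\phi(y^\delta)\|_2^2+\lambda\left(\mathbb{E}_{\pi_{y^\delta}}[\mathcal{R}(\mathcal{G}_\phi(y^\delta))]-\mathbb{E}_{\pi_x}[\mathcal{R}(x)]\right),$$ $$J_2(\mathcal{G}_\phi|\lambda,\pi_{y^\delta}):=\mathbb{E}_{\pi_{y^\delta}}\|y^\delta-\mathcal{A}\mathcal{G}_\phi(y^\delta)\|_2^2+\lambda\,\mathbb{W}_1(\pi_x,(\mathcal{G}_\phi)_\#\pi_{y^\delta}).$$ Optimality: $\mathcal{G}_{\phi^*}$ ($\phi^*\in K$) is optimal for (P2) if $\phi^*$ attains the infimum. A pair $(\mathcal{G}_{\phi^*},\mathcal{R}^* )$ with $\phi^*\in K$, $\mathcal{R}^*\in\mathbb{L}_1$ is optimal for (P1) if $\phi^*$ attains the infimum over $\phi\in K$ of $\sup_{\mathcal{R}\in\mathbb{L}_1}J_1(\mathcal{G}_\phi,\mathcal{R}|\lambda,\pi_{y^\delta})$ and $\mathcal{R}^*$ attains $\sup_{\mathcal{R}\in\mathbb{L}_1}J_1(\mathcal{G}_{\phi^*},\mathcal{R}|\lambda,\pi_{y^\delta})$. *)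

theory Defs
  imports "HOL-Probability.Probability"
begin

definition measure_support :: "'a::topological_space measure \<Rightarrow> 'a set" where
  "measure_support M = {x. \<forall>U. open U \<and> x \<in> U \<longrightarrow> emeasure M U > 0}"

(* Extended-valued, so that an unbounded function has norm infinity. *)
definition sup_norm :: "('a \<Rightarrow> 'b::real_normed_vector) \<Rightarrow> ennreal" where
  "sup_norm f = (SUP x. ennreal (norm (f x)))"

definition couplings :: "'a::euclidean_space measure \<Rightarrow> 'a measure \<Rightarrow> ('a \<times> 'a) measure set" where
  "couplings M N = {\<mu>. prob_space \<mu> \<and> sets \<mu> = sets borel \<and>
     distr \<mu> borel fst = M \<and> distr \<mu> borel snd = N}"

definition wasserstein1 :: "'a::euclidean_space measure \<Rightarrow> 'a measure \<Rightarrow> ennreal" where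
  "wasserstein1 M N = (INF \<mu>\<in>couplings M N. \<integral>\<^sup>+ z. ennreal (norm (fst z - snd z)) \<partial>\<mu>)"

definition Lip1 :: "(real ^ 'n \<Rightarrow> real) set" where
  "Lip1 = {R. 1-lipschitz_on UNIV R}"

(* A bounded measurable G and compactly supported distributions make the integrands below
   integrable, so the Bochner integrals are the true expectations. *)

definition J1 ::
  "(real ^ 'n \<Rightarrow> real ^ 'k) \<Rightarrow> (real ^ 'n) measure \<Rightarrow> (real ^ 'k \<Rightarrow> real ^ 'n) \<Rightarrow>
   (real ^ 'n \<Rightarrow> real) \<Rightarrow> real \<Rightarrow> (real ^ 'k) measure \<Rightarrow> real" where
  "J1 A pix g R lam piy =
     (\<integral>y. (norm (y - A (g y)))\<^sup>2 \<partial>piy) + lam * ((\<integral>y. R (g y) \<partial>piy) - (\<integral>x. R x \<partial>pix))"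

definition J2 ::
  "(real ^ 'n \<Rightarrow> real ^ 'k) \<Rightarrow> (real ^ 'n) measure \<Rightarrow> (real ^ 'k \<Rightarrow> real ^ 'n) \<Rightarrow>
   real \<Rightarrow> (real ^ 'k) measure \<Rightarrow> ereal" where
  "J2 A pix g lam piy =
     ereal (\<integral>y. (norm (y - A (g y)))\<^sup>2 \<partial>piy) +
     ereal lam * enn2ereal (wasserstein1 pix (distr piy borel g))"

(* Suprema and infima are taken in the extended reals: on type real they would be
   unspecified for unbounded families. *)

definition sup_J1 ::
  "(real ^ 'n \<Rightarrow> real ^ 'k) \<Rightarrow> (real ^ 'n) measure \<Rightarrow> (real ^ 'k \<Rightarrow> real ^ 'n) \<Rightarrow>
   real \<Rightarrow> (real ^ 'k) measure \<Rightarrow> ereal" where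
  "sup_J1 A pix g lam piy = (SUP R\<in>Lip1. ereal (J1 A pix g R lam piy))"

definition optimal_P1 ::
  "(real ^ 'n \<Rightarrow> real ^ 'k) \<Rightarrow> (real ^ 'n) measure \<Rightarrow> ('p \<Rightarrow> real ^ 'k \<Rightarrow> real ^ 'n) \<Rightarrow> 'p set \<Rightarrow>
   real \<Rightarrow> (real ^ 'k) measure \<Rightarrow> 'p \<Rightarrow> (real ^ 'n \<Rightarrow> real) \<Rightarrow> bool" where
  "optimal_P1 A pix G K lam piy \<phi> R \<longleftrightarrow>
     \<phi> \<in> K \<and> R \<in> Lip1 \<and>
     sup_J1 A pix (G \<phi>) lam piy = (INF \<psi>\<in>K. sup_J1 A pix (G \<psi>) lam piy) \<and>
     ereal (J1 A pix (G \<phi>) R lam piy) = sup_J1 A pix (G \<phi>) lam piy"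

definition optimal_P2 ::
  "(real ^ 'n \<Rightarrow> real ^ 'k) \<Rightarrow> (real ^ 'n) measure \<Rightarrow> ('p \<Rightarrow> real ^ 'k \<Rightarrow> real ^ 'n) \<Rightarrow> 'p set \<Rightarrow>
   real \<Rightarrow> (real ^ 'k) measure \<Rightarrow> 'p \<Rightarrow> bool" where
  "optimal_P2 A pix G K lam piy \<phi> \<longleftrightarrow>
     \<phi> \<in> K \<and> J2 A pix (G \<phi>) lam piy = (INF \<psi>\<in>K. J2 A pix (G \<psi>) lam piy)"

end

theory Submission
  imports Defs "HOL-Complex_Analysis.Great_Picard"
begin

text \<open>By Kantorovich-Rubinstein duality the inner supremum of (P1) equals the objective of (P2) for each
  parameter, and it is attained.  As a supremum of functionals that are continuous in the parameter
  (dominated convergence), it is lower semicontinuous, hence attains its infimum over \<open>K\<close>.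

  The duality for boundedly supported measures is reduced to finite transport: cut a ball carrying
  both measures into small cells, solve the transport problem between the cell masses, and spread the
  finite plan over products of cells.  No limit of couplings is taken, because the Wasserstein
  distance is an infimum and every coupling obtained this way bounds it up to the cell diameter.\<close>

section \<open>Finite transport duality\<close>

text \<open>The finite problem is posed as feasibility: is there a plan of cost at most
  \<open>D\<close>, where \<open>D\<close> bounds the dual value of every 1-Lipschitz function? A
  theorem of the alternative decides this, and a negative answer would come with multipliers that
  assemble into a 1-Lipschitz function of dual value above \<open>D\<close>. That function is a
  minimum of shifted distance functions, hence defined on the whole space at once. This matters
  because the bound by \<open>D\<close> comes from integrals against the original measures, not from
  values at the cell centres alone.

  Discretisation is paid for twice, in the dual integrals and in the transport cost; both prices are
  multiples of the cell size and vanish with it. The maximising potential is found separately from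
  the transport side: (P1) asks for it anyway, and its dual value is the real number to which the
  Wasserstein distance is compared.\<close>

definition prob_simplex :: "'i set \<Rightarrow> ('i \<Rightarrow> real) set" where
  "prob_simplex Z = {p. (\<forall>z\<in>Z. 0 \<le> p z) \<and> (\<forall>z. z \<notin> Z \<longrightarrow> p z = 0) \<and> sum p Z = 1}"

text \<open>Tychonoff: since \<open>p\<close> vanishes off \<open>Z\<close>, every coordinate ranges
  over a compact set, \<open>{0..1}\<close> or \<open>{0}\<close>; what remains is one closed linear
  equation.\<close>

lemma compact_prob_simplex:
  assumes "finite Z"
  shows "compact (prob_simplex Z)"
proof -
  let ?B = "PiE UNIV (\<lambda>z. if z \<in> Z then {0..1::real} else {0})"
  have "compactin (product_topology (\<lambda>i. euclidean) UNIV) ?B"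
    unfolding compactin_PiE by auto
  then have B: "compact ?B"
    by (simp add: euclidean_product_topology)
  have coord: "continuous_on UNIV (\<lambda>p::'a \<Rightarrow> real. p z)" for z
    by simp
  have cl: "closed {p::'a \<Rightarrow> real. sum p Z = 1}"
    by (rule closed_Collect_eq) (intro continuous_intros coord)+
  have "p z \<le> 1" if "p \<in> prob_simplex Z" "z \<in> Z" for p z
  proof -
    have "p z \<le> sum p Z"
      using that assms by (intro member_le_sum) (auto simp: prob_simplex_def)
    then show ?thesis
      using that by (simp add: prob_simplex_def)
  qed
  then have "prob_simplex Z = ?B \<inter> {p. sum p Z = 1}"
    by (fastforce simp: prob_simplex_def PiE_UNIV_domain Pi_iff split: if_splits)
  then show ?thesis
    using compact_Int_closed[OF B cl] by simp
qed

text \<open>A first-order expansion of the squared positive part with quadratic remainder; it takes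
  the place of a derivative when the sum of squared violations is minimised.\<close>

lemma max_zero_square_add_le:
  fixes x h :: real
  shows "(max 0 (x + h))\<^sup>2 \<le> (max 0 x)\<^sup>2 + 2 * h * max 0 x + h\<^sup>2"
proof -
  have "max 0 (x + h) \<le> \<bar>max 0 x + h\<bar>"
    by (auto simp: max_def)
  then have "(max 0 (x + h))\<^sup>2 \<le> (max 0 x + h)\<^sup>2"
    by (metis abs_le_square_iff abs_of_nonneg max.cobounded1)
  then show ?thesis
    by (simp add: power2_eq_square algebra_simps)
qed

text \<open>A point of the simplex minimising the sum of squared constraint violations either satisfies
  all constraints, or its violations are the multipliers of the second alternative.\<close>

lemma ville_alternative:
  fixes W :: "'k \<Rightarrow> 'i \<Rightarrow> real"
  assumes "finite Z" "Z \<noteq> {}" "finite H"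
  shows "(\<exists>p\<in>prob_simplex Z. \<forall>k\<in>H. (\<Sum>z\<in>Z. p z * W k z) \<le> 0) \<or>
         (\<exists>y. (\<forall>k\<in>H. 0 \<le> y k) \<and> (\<forall>z\<in>Z. 0 < (\<Sum>k\<in>H. y k * W k z)))"
proof -
  define L where "L k p = (\<Sum>z\<in>Z. p z * W k z)" for k and p :: "'i \<Rightarrow> real"
  define \<Phi> where "\<Phi> p = (\<Sum>k\<in>H. (max 0 (L k p))\<^sup>2)" for p
  obtain z0 where "z0 \<in> Z" using assms by auto
  then have "(\<lambda>z. if z = z0 then 1 else 0) \<in> prob_simplex Z"
    using assms by (auto simp: prob_simplex_def)
  then have ne: "prob_simplex Z \<noteq> {}" by blast
  have coord: "continuous_on (prob_simplex Z) (\<lambda>p. p z)" for z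
    by (rule continuous_on_subset[of UNIV]) simp_all
  have "continuous_on (prob_simplex Z) \<Phi>"
    unfolding \<Phi>_def L_def by (intro continuous_intros coord)
  then obtain p where p: "p \<in> prob_simplex Z" and pmin: "\<And>q. q \<in> prob_simplex Z \<Longrightarrow> \<Phi> p \<le> \<Phi> q"
    using continuous_attains_inf[OF compact_prob_simplex[OF assms(1)] ne] by blast
  define y where "y k = max 0 (L k p)" for k
  show ?thesis
  proof (cases "\<Phi> p = 0")
    case True
    then have "\<forall>k\<in>H. L k p \<le> 0"
      unfolding \<Phi>_def using assms by (subst (asm) sum_nonneg_eq_0_iff) (auto simp: max_def split: if_splits)
    then show ?thesis using p unfolding L_def by blast
  next
    case False
    then have pos: "0 < \<Phi> p"
      unfolding \<Phi>_def by (metis sum_nonneg zero_le_power2 order_le_less)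
    have "0 < (\<Sum>k\<in>H. y k * W k z)" if z: "z \<in> Z" for z
    proof -
      \<comment> \<open>On the segment from \<open>p\<close> to the vertex of the simplex at
        \<open>z\<close>, the objective is at most
        \<open>\<Phi> p + 2 * t * \<alpha> + t\<^sup>2 * C\<close>. So \<open>2 * \<alpha>\<close>
        is the slope of this bound at \<open>p\<close>, and minimality must make it
        nonnegative.\<close>
      define \<alpha> where "\<alpha> = (\<Sum>k\<in>H. y k * (W k z - L k p))"
      define C where "C = (\<Sum>k\<in>H. (W k z - L k p)\<^sup>2)"
      have C: "0 \<le> C" unfolding C_def by (intro sum_nonneg) auto
      have step: "0 \<le> 2 * \<alpha> + t * C" if t: "0 < t" "t \<le> 1" for t
      proof -
        define q where "q w = (1 - t) * p w + t * (if w = z then 1 else 0)" for w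
        have "sum q Z = 1"
          using p z assms(1) unfolding q_def prob_simplex_def
          by (simp add: sum.distrib sum_distrib_left[symmetric])
        then have "q \<in> prob_simplex Z"
          using p z t by (auto simp: prob_simplex_def q_def)
        then have "\<Phi> p \<le> \<Phi> q" by (rule pmin)
        moreover have Lq: "L k q = L k p + t * (W k z - L k p)" for k
        proof -
          have "L k q = (1 - t) * L k p + t * (\<Sum>w\<in>Z. (if w = z then 1 else 0) * W k w)"
            unfolding L_def q_def
            by (simp add: sum.distrib sum_distrib_left algebra_simps sum_subtractf)
          also have "(\<Sum>w\<in>Z. (if w = z then 1 else 0) * W k w) = W k z"
            using z assms(1) by (simp add: if_distrib[of "\<lambda>c. c * _"] cong: if_cong)
          finally show ?thesis by (simp add: algebra_simps)
        qed
        have "\<Phi> q \<le> (\<Sum>k\<in>H. (y k)\<^sup>2 + 2 * (t * (W k z - L k p)) * y k + (t * (W k z - L k p))\<^sup>2)"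
          unfolding \<Phi>_def Lq y_def by (intro sum_mono max_zero_square_add_le)
        also have "\<dots> = \<Phi> p + 2 * t * \<alpha> + t\<^sup>2 * C"
          unfolding \<Phi>_def \<alpha>_def C_def y_def[symmetric]
          by (simp add: sum.distrib sum_distrib_left power_mult_distrib mult_ac)
        finally have "\<Phi> p \<le> \<Phi> p + 2 * t * \<alpha> + t\<^sup>2 * C" using \<open>\<Phi> p \<le> \<Phi> q\<close> by simp
        then have "0 \<le> t * (2 * \<alpha> + t * C)" by (simp add: power2_eq_square algebra_simps)
        then show ?thesis using t by (simp add: zero_le_mult_iff)
      qed
      have "0 \<le> \<alpha>"
      proof (rule ccontr)
        assume "\<not> 0 \<le> \<alpha>"
        \<comment> \<open>Small enough that \<open>t * C \<le> - \<alpha>\<close>, so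
          \<open>2 * \<alpha> + t * C\<close> would be at most \<open>\<alpha>\<close> and thus
          negative; \<open>C + 1\<close> avoids a division by zero.\<close>
        define t where "t = min 1 (- \<alpha> / (C + 1))"
        have t: "0 < t" "t \<le> 1" using \<open>\<not> 0 \<le> \<alpha>\<close> C by (auto simp: t_def divide_neg_pos)
        have "t * C \<le> t * (C + 1)" using t by simp
        also have "\<dots> \<le> - \<alpha> / (C + 1) * (C + 1)"
          using C by (intro mult_right_mono) (auto simp: t_def)
        also have "\<dots> = - \<alpha>" using C by simp
        finally show False using step[OF t] \<open>\<not> 0 \<le> \<alpha>\<close> by simp
      qed
      \<comment> \<open>Each product is a squared violation. Hence \<open>\<alpha>\<close> is the
        combination of the \<open>W k z\<close> with weights \<open>y k\<close> minus
        \<open>\<Phi> p\<close>, and that combination is at least \<open>\<Phi> p\<close>.\<close>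
      moreover have "(\<Sum>k\<in>H. y k * L k p) = \<Phi> p"
        unfolding \<Phi>_def y_def by (intro sum.cong) (auto simp: max_def power2_eq_square)
      ultimately have "\<Phi> p \<le> (\<Sum>k\<in>H. y k * W k z)"
        unfolding \<alpha>_def by (simp add: algebra_simps sum_subtractf)
      then show ?thesis using pos by simp
    qed
    moreover have "\<forall>k\<in>H. 0 \<le> y k" by (simp add: y_def)
    ultimately show ?thesis by blast
  qed
qed

section \<open>Transport between finitely many points\<close>

text \<open>A lower envelope of unit cones, one at each \<open>x i\<close> with apex height
  \<open>u i\<close>: the shape of the potential that the transport multipliers produce. The index
  attaining the minimum at one point is a competitor at the other.\<close>

lemma lipschitz_on_Min_dist_add:
  fixes x :: "'i \<Rightarrow> 'a::metric_space" and u :: "'i \<Rightarrow> real"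
  assumes "finite I" "I \<noteq> {}"
  shows "1-lipschitz_on UNIV (\<lambda>z. MIN i\<in>I. dist z (x i) + u i)"
proof (rule lipschitz_onI)
  fix z w :: 'a
  have *: "(MIN i\<in>I. dist z (x i) + u i) \<le> (MIN i\<in>I. dist w (x i) + u i) + dist z w" for z w :: 'a
  proof -
    have "(MIN i\<in>I. dist w (x i) + u i) \<in> (\<lambda>i. dist w (x i) + u i) ` I"
      using assms by (intro Min_in) auto
    then obtain i where i: "i \<in> I" "(MIN i\<in>I. dist w (x i) + u i) = dist w (x i) + u i" by auto
    have "(MIN i\<in>I. dist z (x i) + u i) \<le> dist z (x i) + u i"
      using assms i by (intro Min_le) auto
    also have "\<dots> \<le> dist w (x i) + u i + dist z w"
      using dist_triangle[of z "x i" w] by simp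
    finally show ?thesis using i by simp
  qed
  show "dist (MIN i\<in>I. dist z (x i) + u i) (MIN i\<in>I. dist w (x i) + u i) \<le> 1 * dist z w"
    using *[of z w] *[of w z] by (simp add: dist_real_def dist_commute abs_le_iff)
qed simp

text \<open>The plan is a point of the simplex over \<open>I \<times> I\<close> subject to linear
  inequalities. Were they infeasible, the multipliers of the alternative would yield either a
  contradiction with the product plan or a 1-Lipschitz function violating \<open>D\<close>.\<close>

lemma finite_kantorovich_duality:
  fixes x :: "'i \<Rightarrow> 'a::metric_space" and a b :: "'i \<Rightarrow> real"
  assumes fin: "finite I"
    and a: "\<And>i. i \<in> I \<Longrightarrow> 0 \<le> a i" "sum a I = 1"
    and b: "\<And>i. i \<in> I \<Longrightarrow> 0 \<le> b i" "sum b I = 1"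
    and D: "\<And>f. 1-lipschitz_on UNIV f \<Longrightarrow> (\<Sum>i\<in>I. f (x i) * b i) - (\<Sum>i\<in>I. f (x i) * a i) \<le> D"
  obtains p :: "'i \<Rightarrow> 'i \<Rightarrow> real" where
    "\<And>i j. i \<in> I \<Longrightarrow> j \<in> I \<Longrightarrow> 0 \<le> p i j"
    "\<And>i. i \<in> I \<Longrightarrow> (\<Sum>j\<in>I. p i j) = a i"
    "\<And>j. j \<in> I \<Longrightarrow> (\<Sum>i\<in>I. p i j) = b j"
    "(\<Sum>i\<in>I. \<Sum>j\<in>I. p i j * dist (x i) (x j)) \<le> D"
proof -
  have ne: "I \<noteq> {}" using a by auto
  have "\<exists>i\<in>I. a i \<noteq> 0" "\<exists>i\<in>I. b i \<noteq> 0"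
    using a(2) b(2) by (metis sum.neutral zero_neq_one)+
  then obtain i0 j0 where i0: "i0 \<in> I" "0 < a i0" and j0: "j0 \<in> I" "0 < b j0"
    using a(1) b(1) by (metis order_le_less)
  \<comment> \<open>The constants are subtracted inside each constraint: weights in the simplex sum
    to 1, so a nonpositive weighted sum bounds a row sum by \<open>a i\<close>, a column sum by
    \<open>b j\<close>, or the cost by \<open>D\<close>. Upper bounds on the marginals become
    equalities because all total masses are 1.\<close>
  define W :: "('i + 'i) + unit \<Rightarrow> 'i \<times> 'i \<Rightarrow> real" where
    "W k z = (case k of Inl (Inl i) \<Rightarrow> of_bool (fst z = i) - a i
                      | Inl (Inr j) \<Rightarrow> of_bool (snd z = j) - b j
                      | Inr _ \<Rightarrow> dist (x (fst z)) (x (snd z)) - D)" for k z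
  let ?H = "(I <+> I) <+> {()}"
  let ?Z = "I \<times> I"
  have "\<nexists>y. (\<forall>k\<in>?H. 0 \<le> y k) \<and> (\<forall>z\<in>?Z. 0 < (\<Sum>k\<in>?H. y k * W k z))"
  proof (rule notI, elim exE conjE)
    fix y assume y0: "\<forall>k\<in>?H. 0 \<le> y k" and ypos: "\<forall>z\<in>?Z. 0 < (\<Sum>k\<in>?H. y k * W k z)"
    define u v s where "u i = y (Inl (Inl i))" and "v i = y (Inl (Inr i))" and "s = y (Inr ())" for i
    define c where "c = (\<Sum>i\<in>I. u i * a i) + (\<Sum>i\<in>I. v i * b i)"
    have s: "0 \<le> s" using y0 by (auto simp: s_def)
    have uv: "0 < u i + v j - c + s * (dist (x i) (x j) - D)" if "i \<in> I" "j \<in> I" for i j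
    proof -
      have "0 < (\<Sum>k\<in>?H. y k * W k (i, j))" using ypos that by auto
      also have "\<dots> = (\<Sum>k\<in>I. u k * (of_bool (i = k) - a k)) + (\<Sum>k\<in>I. v k * (of_bool (j = k) - b k))
          + s * (dist (x i) (x j) - D)"
        using fin by (simp add: sum.Plus W_def u_def v_def s_def)
      also have "(\<Sum>k\<in>I. u k * (of_bool (i = k) - a k)) = u i - (\<Sum>k\<in>I. u k * a k)"
        using fin that by (simp add: right_diff_distrib sum_subtractf)
      also have "(\<Sum>k\<in>I. v k * (of_bool (j = k) - b k)) = v j - (\<Sum>k\<in>I. v k * b k)"
        using fin that by (simp add: right_diff_distrib sum_subtractf)
      finally show ?thesis by (simp add: c_def)
    qed
    show False
    proof (cases "s = 0")
      case True
      \<comment> \<open>Without a cost multiplier the inequalities read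
        \<open>c < u i + v j\<close>. Averaged with the weights \<open>a i * b j\<close> the right
        side is exactly \<open>c\<close>; the points \<open>i0\<close> and \<open>j0\<close> of
        positive mass keep the inequality strict.\<close>
      have "0 < (\<Sum>j\<in>I. b j * (\<Sum>i\<in>I. a i * (u i + v j - c)))"
      proof (rule sum_pos2[OF fin j0(1)])
        have *: "0 \<le> (\<Sum>i\<in>I. a i * (u i + v j - c))" if "j \<in> I" for j
          using uv[OF _ that] True a by (intro sum_nonneg) (simp add: less_imp_le)
        show "0 \<le> b j * (\<Sum>i\<in>I. a i * (u i + v j - c))" if "j \<in> I" for j
          using * b that by simp
        have "0 < (\<Sum>i\<in>I. a i * (u i + v j0 - c))"
          using uv[OF _ j0(1)] True a i0 by (intro sum_pos2[OF fin i0(1)]) (simp_all add: less_imp_le)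
        then show "0 < b j0 * (\<Sum>i\<in>I. a i * (u i + v j0 - c))" using j0 by simp
      qed
      also have "(\<Sum>j\<in>I. b j * (\<Sum>i\<in>I. a i * (u i + v j - c)))
          = (\<Sum>j\<in>I. b j * ((\<Sum>i\<in>I. u i * a i) + (v j - c)))"
        using a(2) by (simp add: distrib_left right_diff_distrib sum.distrib sum_subtractf
            sum_distrib_left[symmetric] sum_distrib_right[symmetric] mult.commute)
      also have "(\<Sum>j\<in>I. b j * ((\<Sum>i\<in>I. u i * a i) + (v j - c))) = (\<Sum>i\<in>I. u i * a i) + (\<Sum>i\<in>I. v i * b i) - c"
        using b(2) by (simp add: distrib_left right_diff_distrib sum.distrib sum_subtractf
            sum_distrib_left[symmetric] sum_distrib_right[symmetric] mult.commute)
      finally show False by (simp add: c_def)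
    next
      case False
      then have s: "0 < s" using s by simp
      \<comment> \<open>Dividing by the cost multiplier \<open>s\<close> turns \<open>u i\<close>
        into a height in units of distance. The envelope lies below \<open>u i / s\<close> at
        \<open>x i\<close>.\<close>
      define f where "f z = (MIN i\<in>I. dist z (x i) + u i / s)" for z
      have fu: "f (x i) \<le> u i / s" if "i \<in> I" for i
      proof -
        have "f (x i) \<le> dist (x i) (x i) + u i / s"
          unfolding f_def using fin that by (intro Min_le rev_image_eqI[OF that]) simp_all
        then show ?thesis by simp
      qed
      \<comment> \<open>The index \<open>i\<close> attaining the minimum at \<open>x j\<close> makes
        \<open>f (x j)\<close> appear exactly in the strict inequality for the pair
        \<open>i\<close>, \<open>j\<close>.\<close>
      have fv: "0 < f (x j) + v j / s - c / s - D" if j: "j \<in> I" for j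
      proof -
        have "f (x j) \<in> (\<lambda>i. dist (x j) (x i) + u i / s) ` I"
          unfolding f_def using fin ne by (intro Min_in) auto
        then obtain i where i: "i \<in> I" "f (x j) = dist (x j) (x i) + u i / s" by auto
        have "0 < (u i + v j - c + s * (dist (x i) (x j) - D)) / s"
          using uv[OF i(1) j] s by simp
        also have "\<dots> = f (x j) + v j / s - c / s - D"
          using s i(2) by (simp add: field_simps dist_commute)
        finally show ?thesis .
      qed
      have "0 < (\<Sum>j\<in>I. b j * (f (x j) + v j / s - c / s - D))"
        using fv b j0 by (intro sum_pos2[OF fin j0(1)]) (simp_all add: less_imp_le)
      also have "\<dots> = (\<Sum>j\<in>I. f (x j) * b j) + (\<Sum>j\<in>I. v j * b j) / s - c / s - D"
        using b(2) by (simp add: distrib_left right_diff_distrib sum.distrib sum_subtractf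
            sum_distrib_left[symmetric] sum_distrib_right[symmetric] sum_divide_distrib[symmetric] mult.commute)
      finally have 1: "D + c / s - (\<Sum>j\<in>I. v j * b j) / s < (\<Sum>j\<in>I. f (x j) * b j)" by simp
      have "(\<Sum>i\<in>I. f (x i) * a i) \<le> (\<Sum>i\<in>I. u i / s * a i)"
        using fu a by (intro sum_mono mult_right_mono) auto
      also have "\<dots> = (\<Sum>i\<in>I. u i * a i) / s" by (simp add: sum_divide_distrib)
      finally have "D < (\<Sum>j\<in>I. f (x j) * b j) - (\<Sum>i\<in>I. f (x i) * a i)"
        using 1 by (simp add: c_def add_divide_distrib)
      moreover have "1-lipschitz_on UNIV f"
        unfolding f_def using fin ne by (rule lipschitz_on_Min_dist_add)
      ultimately show False using D[of f] by simp
    qed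
  qed
  moreover have "finite ?Z" "?Z \<noteq> {}" "finite ?H" using fin ne by auto
  ultimately obtain q where q: "q \<in> prob_simplex ?Z" and qle: "\<forall>k\<in>?H. (\<Sum>z\<in>?Z. q z * W k z) \<le> 0"
    using ville_alternative[of ?Z ?H W] by blast
  define p where "p i j = q (i, j)" for i j
  have p0: "0 \<le> p i j" if "i \<in> I" "j \<in> I" for i j
    using q that by (auto simp: p_def prob_simplex_def)
  have sum_Z: "(\<Sum>z\<in>?Z. q z * g z) = (\<Sum>i\<in>I. \<Sum>j\<in>I. p i j * g (i, j))" for g
    by (simp add: sum.cartesian_product p_def)
  have total: "(\<Sum>i\<in>I. \<Sum>j\<in>I. p i j) = 1"
    using q sum_Z[of "\<lambda>_. 1"] by (simp add: prob_simplex_def)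
  have shift: "(\<Sum>z\<in>?Z. q z * (g z - r)) = (\<Sum>i\<in>I. \<Sum>j\<in>I. p i j * g (i, j)) - r" for g r
  proof -
    have "(\<Sum>z\<in>?Z. q z * (g z - r)) = (\<Sum>z\<in>?Z. q z * g z) - sum q ?Z * r"
      by (simp add: right_diff_distrib sum_subtractf sum_distrib_right)
    then show ?thesis using q sum_Z[of g] by (simp add: prob_simplex_def)
  qed
  have eq_of_le: "g i = h i" if "\<And>i. i \<in> I \<Longrightarrow> g i \<le> h i" "sum g I = 1" "sum h I = 1" "i \<in> I"
    for g h :: "'i \<Rightarrow> real" and i
  proof -
    have "(\<Sum>i\<in>I. h i - g i) = 0" using that by (simp add: sum_subtractf)
    then have "\<forall>i\<in>I. h i - g i = 0" using fin that by (subst (asm) sum_nonneg_eq_0_iff) auto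
    then show ?thesis using that(4) by auto
  qed
  have row_le: "(\<Sum>j\<in>I. p i j) \<le> a i" if "i \<in> I" for i
  proof -
    have "(\<Sum>z\<in>?Z. q z * (of_bool (fst z = i) - a i)) \<le> 0"
      using bspec[OF qle InlI[OF InlI[OF that]]] by (simp add: W_def)
    moreover have "(\<Sum>i'\<in>I. \<Sum>j\<in>I. p i' j * of_bool (i' = i)) = (\<Sum>j\<in>I. p i j)"
      using fin that by (simp add: sum_distrib_right[symmetric])
    ultimately show ?thesis unfolding shift by simp
  qed
  have col_le: "(\<Sum>i\<in>I. p i j) \<le> b j" if "j \<in> I" for j
  proof -
    have "(\<Sum>z\<in>?Z. q z * (of_bool (snd z = j) - b j)) \<le> 0"
      using bspec[OF qle InlI[OF InrI[OF that]]] by (simp add: W_def)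
    moreover have "(\<Sum>i\<in>I. \<Sum>j'\<in>I. p i j' * of_bool (j' = j)) = (\<Sum>i\<in>I. p i j)"
      using fin that by simp
    ultimately show ?thesis unfolding shift by simp
  qed
  have cost: "(\<Sum>i\<in>I. \<Sum>j\<in>I. p i j * dist (x i) (x j)) \<le> D"
    using bspec[OF qle InrI[OF singletonI]] shift[of "\<lambda>z. dist (x (fst z)) (x (snd z))" D] by (simp add: W_def)
  have total': "(\<Sum>j\<in>I. \<Sum>i\<in>I. p i j) = 1"
    using total by (subst sum.swap)
  show thesis
    using that[of p] p0 cost eq_of_le[of "\<lambda>i. \<Sum>j\<in>I. p i j" a] eq_of_le[of "\<lambda>j. \<Sum>i\<in>I. p i j" b]
      row_le col_le total total' a(2) b(2) by blast
qed

section \<open>Kantorovich-Rubinstein duality\<close>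

text \<open>The complement of the support is a union of open null sets, and by Lindelof countably
  many of them already cover it.\<close>

lemma AE_measure_support:
  fixes M :: "'a::second_countable_topology measure"
  assumes "sets M = sets borel"
  shows "AE x in M. x \<in> measure_support M"
proof -
  define F where "F = {U. open U \<and> emeasure M U = 0}"
  obtain F' where F': "F' \<subseteq> F" "countable F'" "\<Union>F' = \<Union>F"
    using Lindelof[of F] unfolding F_def by blast
  have "(\<Union>U\<in>F'. U) \<in> null_sets M"
    using F' assms by (intro null_sets_UN') (auto simp: F_def null_sets_def)
  moreover have "{x \<in> space M. x \<notin> measure_support M} \<subseteq> (\<Union>U\<in>F'. U)"
    using F'(3) by (auto simp: F_def measure_support_def)
  ultimately show ?thesis by (rule AE_I')
qed

lemma borel_measurable_lipschitz:
  fixes f :: "'a::metric_space \<Rightarrow> 'b::metric_space"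
  shows "C-lipschitz_on UNIV f \<Longrightarrow> f \<in> borel_measurable borel"
  by (intro borel_measurable_continuous_onI lipschitz_on_continuous_on)

lemma abs_lipschitz_le:
  fixes f :: "'a::real_normed_vector \<Rightarrow> real"
  assumes "1-lipschitz_on UNIV f"
  shows "\<bar>f x\<bar> \<le> \<bar>f 0\<bar> + norm x"
  using lipschitz_onD[OF assms, of x 0] by (simp add: dist_real_def)

lemma integrable_lipschitz:
  fixes f :: "'a::real_normed_vector \<Rightarrow> real"
  assumes "prob_space M" "sets M = sets borel" "AE x in M. norm x \<le> r" "1-lipschitz_on UNIV f"
  shows "integrable M f"
proof -
  interpret prob_space M by fact
  have "f \<in> borel_measurable M"
    using borel_measurable_lipschitz[OF assms(4)] assms(2) by (simp cong: measurable_cong_sets)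
  then show ?thesis
  proof (rule integrable_const_bound[rotated])
    show "AE x in M. norm (f x) \<le> \<bar>f 0\<bar> + r"
      using assms(3)
    proof eventually_elim
      case (elim x)
      then show ?case using abs_lipschitz_le[OF assms(4), of x] by simp
    qed
  qed
qed

text \<open>The easy half of duality: under any coupling the difference of integrals is the integral
  of \<open>f (snd z) - f (fst z)\<close>, which the distance dominates pointwise. Negative
  differences are truncated to 0 by \<open>ennreal\<close>.\<close>

lemma lipschitz_le_wasserstein1:
  fixes M N :: "'a::euclidean_space measure"
  assumes f: "1-lipschitz_on UNIV f" and int: "integrable M f" "integrable N f"
  shows "ennreal ((\<integral>x. f x \<partial>N) - (\<integral>x. f x \<partial>M)) \<le> wasserstein1 M N"
  unfolding wasserstein1_def
proof (rule INF_greatest)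
  fix \<mu> assume "\<mu> \<in> couplings M N"
  then have sets: "sets \<mu> = sets borel" and marg: "distr \<mu> borel fst = M" "distr \<mu> borel snd = N"
    by (auto simp: couplings_def)
  have fs: "fst \<in> \<mu> \<rightarrow>\<^sub>M borel" "snd \<in> \<mu> \<rightarrow>\<^sub>M borel"
    using sets by (auto simp: borel_prod[symmetric] cong: measurable_cong_sets)
  note mf = borel_measurable_lipschitz[OF f]
  have i: "integrable \<mu> (\<lambda>z. f (fst z))" "integrable \<mu> (\<lambda>z. f (snd z))"
    using int fs mf by (simp_all add: marg[symmetric] integrable_distr_eq)
  have "(\<integral>x. f x \<partial>N) - (\<integral>x. f x \<partial>M) = (\<integral>z. f (snd z) - f (fst z) \<partial>\<mu>)"
    using i fs mf by (simp add: marg[symmetric] integral_distr)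
  also have "\<dots> \<le> norm (\<integral>z. f (snd z) - f (fst z) \<partial>\<mu>)" by simp
  finally have "ennreal ((\<integral>x. f x \<partial>N) - (\<integral>x. f x \<partial>M)) \<le> ennreal (norm (\<integral>z. f (snd z) - f (fst z) \<partial>\<mu>))"
    by (rule ennreal_leI)
  also have "\<dots> \<le> (\<integral>\<^sup>+z. norm (f (snd z) - f (fst z)) \<partial>\<mu>)"
    using i by (intro integral_norm_bound_ennreal) simp
  also have "\<dots> \<le> (\<integral>\<^sup>+z. ennreal (norm (fst z - snd z)) \<partial>\<mu>)"
  proof (intro nn_integral_mono ennreal_leI)
    fix z
    show "norm (f (snd z) - f (fst z)) \<le> norm (fst z - snd z)"
      using lipschitz_onD[OF f, of "snd z" "fst z"] by (simp add: dist_norm norm_minus_commute)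
  qed
  finally show "ennreal ((\<integral>x. f x \<partial>N) - (\<integral>x. f x \<partial>M)) \<le> (\<integral>\<^sup>+z. ennreal (norm (fst z - snd z)) \<partial>\<mu>)" .
qed

section \<open>Lifting a finite plan to a coupling\<close>

text \<open>Computes a marginal of the lifted plan, with \<open>m i\<close> the mass of a set inside
  cell \<open>i\<close>. The factor \<open>b j\<close> cancels, also when it is 0, since
  \<open>p i j \<le> b j\<close> then forces \<open>p i j = 0\<close>; summing over \<open>j\<close>
  leaves \<open>a i\<close>, which cancels likewise.\<close>

lemma sum_partition_eq:
  fixes p :: "'i \<Rightarrow> 'i \<Rightarrow> real"
  assumes "finite I"
    and p: "\<And>i j. i \<in> I \<Longrightarrow> j \<in> I \<Longrightarrow> 0 \<le> p i j"
    and row: "\<And>i. i \<in> I \<Longrightarrow> (\<Sum>j\<in>I. p i j) = a i"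
    and col: "\<And>j. j \<in> I \<Longrightarrow> (\<Sum>i\<in>I. p i j) = b j"
    and m: "\<And>i. i \<in> I \<Longrightarrow> a i = 0 \<Longrightarrow> m i = 0"
  shows "(\<Sum>i\<in>I. \<Sum>j\<in>I. p i j / (a i * b j) * (m i * b j)) = sum m I"
proof (intro sum.cong refl)
  fix i assume i: "i \<in> I"
  have "(\<Sum>j\<in>I. p i j / (a i * b j) * (m i * b j)) = (\<Sum>j\<in>I. p i j * (m i / a i))"
  proof (intro sum.cong refl)
    fix j assume j: "j \<in> I"
    have "p i j \<le> b j"
      unfolding col[OF j, symmetric] using assms(1) i j p by (intro member_le_sum) auto
    then have "b j = 0 \<Longrightarrow> p i j = 0" using p[OF i j] by simp
    then show "p i j / (a i * b j) * (m i * b j) = p i j * (m i / a i)" by (cases "b j = 0") auto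
  qed
  also have "\<dots> = a i * (m i / a i)" using row[OF i] by (simp only: sum_distrib_right[symmetric])
  also have "\<dots> = m i" using m[OF i] by auto
  finally show "(\<Sum>j\<in>I. p i j / (a i * b j) * (m i * b j)) = m i" .
qed

text \<open>Unit total mass on the cells makes the part outside them null, so nothing is lost by
  cutting \<open>E\<close> along them.\<close>

lemma (in prob_space) measure_eq_sum_partition:
  assumes "finite I" "A ` I \<subseteq> events" "disjoint_family_on A I" "(\<Sum>i\<in>I. prob (A i)) = 1" "E \<in> events"
  shows "prob E = (\<Sum>i\<in>I. prob (E \<inter> A i))"
proof -
  have un: "(\<Union>i\<in>I. A i) \<in> events" using assms by (intro sets.finite_UN) auto
  have "prob (\<Union>i\<in>I. A i) = 1"
    using assms finite_measure_finite_Union[of I A] by simp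
  then have "AE x in M. x \<in> (\<Union>i\<in>I. A i)" using un by (simp only: prob_eq_1)
  then have "prob E = prob (E \<inter> (\<Union>i\<in>I. A i))"
    using assms un by (intro finite_measure_eq_AE) auto
  also have "E \<inter> (\<Union>i\<in>I. A i) = (\<Union>i\<in>I. E \<inter> A i)" by auto
  also have "prob \<dots> = (\<Sum>i\<in>I. prob (E \<inter> A i))"
    using assms by (intro finite_measure_finite_Union) (auto simp: disjoint_family_on_def)
  finally show ?thesis .
qed

text \<open>A plan between the masses of the cells is lifted to a coupling of the measures by spreading
  the mass \<open>p i j\<close> over \<open>A i \<times> A j\<close> proportionally to the product measure.  A cell of
  mass zero makes the quotient \<open>0 / 0 = 0\<close>.\<close>

lemma wasserstein1_le_partition_plan:
  fixes M N :: "'a::euclidean_space measure" and p :: "'i \<Rightarrow> 'i \<Rightarrow> real"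
  assumes "prob_space M" "prob_space N" and sets: "sets M = sets borel" "sets N = sets borel"
    and fin: "finite I" and A: "A ` I \<subseteq> sets borel" "disjoint_family_on A I"
    and tot: "(\<Sum>i\<in>I. measure M (A i)) = 1" "(\<Sum>i\<in>I. measure N (A i)) = 1"
    and p: "\<And>i j. i \<in> I \<Longrightarrow> j \<in> I \<Longrightarrow> 0 \<le> p i j"
    and row: "\<And>i. i \<in> I \<Longrightarrow> (\<Sum>j\<in>I. p i j) = measure M (A i)"
    and col: "\<And>j. j \<in> I \<Longrightarrow> (\<Sum>i\<in>I. p i j) = measure N (A j)"
    and x: "\<And>i z. i \<in> I \<Longrightarrow> z \<in> A i \<Longrightarrow> dist z (x i) \<le> e"
    and e: "0 \<le> e"
  shows "wasserstein1 M N \<le> ennreal (\<Sum>i\<in>I. \<Sum>j\<in>I. p i j * (dist (x i) (x j) + 2 * e))"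
proof -
  interpret M: prob_space M by fact
  interpret N: prob_space N by fact
  interpret MN: pair_prob_space M N ..
  let ?a = "\<lambda>i. measure M (A i)" and ?b = "\<lambda>j. measure N (A j)"
  define P where "P = M \<Otimes>\<^sub>M N"
  define c where "c i j = p i j / (?a i * ?b j)" for i j
  define h where "h z = (\<Sum>i\<in>I. \<Sum>j\<in>I. ennreal (c i j) * indicator (A i \<times> A j) z)" for z
  define \<mu> where "\<mu> = density P h"
  have setsP: "sets P = sets borel"
    unfolding P_def using sets by (simp add: borel_prod[symmetric] cong: sets_pair_measure_cong)
  have c0: "0 \<le> c i j" if "i \<in> I" "j \<in> I" for i j using p that by (simp add: c_def)
  have AM: "A i \<in> sets M" "A i \<in> sets N" if "i \<in> I" for i using A sets that by auto
  have rect: "A i \<times> A j \<in> sets P" if "i \<in> I" "j \<in> I" for i j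
    unfolding P_def using AM that by (intro pair_measureI) auto
  have h_meas[measurable]: "h \<in> borel_measurable P"
    unfolding h_def using rect by (intro borel_measurable_sum borel_measurable_times borel_measurable_indicator) auto
  have int_\<mu>: "(\<integral>\<^sup>+z. F z \<partial>\<mu>) = (\<Sum>i\<in>I. \<Sum>j\<in>I. ennreal (c i j) * (\<integral>\<^sup>+z. F z * indicator (A i \<times> A j) z \<partial>P))"
    if F: "F \<in> borel_measurable P" for F
  proof -
    have "(\<integral>\<^sup>+z. F z \<partial>\<mu>) = (\<integral>\<^sup>+z. h z * F z \<partial>P)"
      unfolding \<mu>_def using F by (intro nn_integral_density) auto
    also have "\<dots> = (\<integral>\<^sup>+z. (\<Sum>i\<in>I. \<Sum>j\<in>I. ennreal (c i j) * (F z * indicator (A i \<times> A j) z)) \<partial>P)"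
      by (simp add: h_def sum_distrib_left sum_distrib_right mult_ac)
    also have "\<dots> = (\<Sum>i\<in>I. \<Sum>j\<in>I. ennreal (c i j) * (\<integral>\<^sup>+z. F z * indicator (A i \<times> A j) z \<partial>P))"
      using F rect by (simp add: nn_integral_sum nn_integral_cmult)
    finally show ?thesis .
  qed
  \<comment> \<open>On rectangles the product measure factorises, and both marginals are read off by
    taking one side to be \<open>UNIV\<close>.\<close>
  have em_\<mu>: "emeasure \<mu> (E \<times> F) = ennreal (\<Sum>i\<in>I. \<Sum>j\<in>I. c i j * (measure M (E \<inter> A i) * measure N (F \<inter> A j)))"
    if E: "E \<in> sets borel" "F \<in> sets borel" for E F
  proof -
    have EF: "E \<times> F \<in> sets P" unfolding P_def using E sets by (intro pair_measureI) auto
    then have "emeasure \<mu> (E \<times> F) = (\<integral>\<^sup>+z. indicator (E \<times> F) z \<partial>\<mu>)"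
      by (simp add: \<mu>_def)
    also have "\<dots> = (\<Sum>i\<in>I. \<Sum>j\<in>I. ennreal (c i j) * (\<integral>\<^sup>+z. indicator (E \<times> F) z * indicator (A i \<times> A j) z \<partial>P))"
      using EF by (intro int_\<mu>) auto
    also have "\<dots> = (\<Sum>i\<in>I. \<Sum>j\<in>I. ennreal (c i j * (measure M (E \<inter> A i) * measure N (F \<inter> A j))))"
    proof (intro sum.cong refl)
      fix i j assume ij: "i \<in> I" "j \<in> I"
      have "(\<integral>\<^sup>+z. indicator (E \<times> F) z * indicator (A i \<times> A j) z \<partial>P) = (\<integral>\<^sup>+z. indicator ((E \<inter> A i) \<times> (F \<inter> A j)) z \<partial>P)"
        by (intro nn_integral_cong) (auto split: split_indicator)
      also have "\<dots> = emeasure P ((E \<inter> A i) \<times> (F \<inter> A j))"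
        using E AM ij sets unfolding P_def by (intro nn_integral_indicator pair_measureI) auto
      also have "\<dots> = emeasure M (E \<inter> A i) * emeasure N (F \<inter> A j)"
        using E AM ij sets unfolding P_def by (intro N.emeasure_pair_measure_Times) auto
      also have "\<dots> = ennreal (measure M (E \<inter> A i) * measure N (F \<inter> A j))"
        by (simp add: M.emeasure_eq_measure N.emeasure_eq_measure ennreal_mult)
      finally show "ennreal (c i j) * (\<integral>\<^sup>+z. indicator (E \<times> F) z * indicator (A i \<times> A j) z \<partial>P)
          = ennreal (c i j * (measure M (E \<inter> A i) * measure N (F \<inter> A j)))"
        using c0[OF ij] by (simp add: ennreal_mult)
    qed
    also have "\<dots> = ennreal (\<Sum>i\<in>I. \<Sum>j\<in>I. c i j * (measure M (E \<inter> A i) * measure N (F \<inter> A j)))"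
      using c0 by (simp add: sum_nonneg)
    finally show ?thesis .
  qed
  have sets_\<mu>: "sets \<mu> = sets borel" by (simp add: \<mu>_def setsP)
  then have space_\<mu>: "space \<mu> = UNIV" using sets_eq_imp_space_eq by fastforce
  have fs: "fst \<in> \<mu> \<rightarrow>\<^sub>M borel" "snd \<in> \<mu> \<rightarrow>\<^sub>M borel"
    using sets_\<mu> by (auto simp: borel_prod[symmetric] cong: measurable_cong_sets)
  have U: "(UNIV :: 'a set) \<in> sets borel" by simp
  have marg1: "distr \<mu> borel fst = M"
  proof (rule measure_eqI)
    fix E :: "'a set" assume "E \<in> sets (distr \<mu> borel fst)"
    then have E: "E \<in> sets borel" by simp
    have "emeasure (distr \<mu> borel fst) E = emeasure \<mu> (E \<times> UNIV)"
      using E fs by (simp add: emeasure_distr space_\<mu> fst_vimage_eq_Times)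
    also have "\<dots> = ennreal (\<Sum>i\<in>I. measure M (E \<inter> A i))"
      unfolding em_\<mu>[OF E U] c_def Int_UNIV_left
    proof (subst sum_partition_eq[OF fin p row col])
      show "measure M (E \<inter> A i) = 0" if "i \<in> I" "?a i = 0" for i
        using M.finite_measure_mono[of "E \<inter> A i" "A i"] AM(1)[OF that(1)] that(2)
        by (simp add: measure_le_0_iff)
    qed auto
    also have "\<dots> = emeasure M E"
      using M.measure_eq_sum_partition[of I A E] fin A tot E sets by (simp add: M.emeasure_eq_measure)
    finally show "emeasure (distr \<mu> borel fst) E = emeasure M E" .
  qed (simp add: sets)
  have marg2: "distr \<mu> borel snd = N"
  proof (rule measure_eqI)
    fix E :: "'a set" assume "E \<in> sets (distr \<mu> borel snd)"
    then have E: "E \<in> sets borel" by simp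
    have "emeasure (distr \<mu> borel snd) E = emeasure \<mu> (UNIV \<times> E)"
      using E fs by (simp add: emeasure_distr space_\<mu> snd_vimage_eq_Times)
    \<comment> \<open>The double sum is rewritten for the transposed plan, so that
      \<open>sum_partition_eq\<close> applies with rows and columns exchanged.\<close>
    also have "\<dots> = ennreal (\<Sum>j\<in>I. \<Sum>i\<in>I. p i j / (?b j * ?a i) * (measure N (E \<inter> A j) * ?a i))"
      unfolding em_\<mu>[OF U E] c_def Int_UNIV_left
      by (subst sum.swap) (simp add: mult.commute)
    also have "\<dots> = ennreal (\<Sum>j\<in>I. measure N (E \<inter> A j))"
    proof (subst sum_partition_eq[OF fin _ col row])
      show "measure N (E \<inter> A i) = 0" if "i \<in> I" "?b i = 0" for i
        using N.finite_measure_mono[of "E \<inter> A i" "A i"] AM(2)[OF that(1)] that(2)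
        by (simp add: measure_le_0_iff)
    qed (auto intro: p)
    also have "\<dots> = emeasure N E"
      using N.measure_eq_sum_partition[of I A E] fin A tot E sets by (simp add: N.emeasure_eq_measure)
    finally show "emeasure (distr \<mu> borel snd) E = emeasure N E" .
  qed (simp add: sets)
  have "prob_space \<mu>"
  proof (rule prob_spaceI)
    have "emeasure M UNIV = emeasure \<mu> (space \<mu>)"
      using fs by (simp add: marg1[symmetric] emeasure_distr)
    then show "emeasure \<mu> (space \<mu>) = 1"
      using M.emeasure_space_1 sets sets_eq_imp_space_eq[of M borel] by simp
  qed
  then have "\<mu> \<in> couplings M N"
    using sets_\<mu> marg1 marg2 by (simp add: couplings_def)
  then have "wasserstein1 M N \<le> (\<integral>\<^sup>+z. ennreal (norm (fst z - snd z)) \<partial>\<mu>)"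
    unfolding wasserstein1_def by (rule INF_lower)
  also have "\<dots> = (\<Sum>i\<in>I. \<Sum>j\<in>I. ennreal (c i j) * (\<integral>\<^sup>+z. ennreal (norm (fst z - snd z)) * indicator (A i \<times> A j) z \<partial>P))"
    using setsP by (intro int_\<mu>) (simp add: borel_prod[symmetric] cong: measurable_cong_sets)
  also have "\<dots> \<le> (\<Sum>i\<in>I. \<Sum>j\<in>I. ennreal (p i j * (dist (x i) (x j) + 2 * e)))"
  proof (intro sum_mono)
    fix i j assume ij: "i \<in> I" "j \<in> I"
    have "(\<integral>\<^sup>+z. ennreal (norm (fst z - snd z)) * indicator (A i \<times> A j) z \<partial>P)
        \<le> (\<integral>\<^sup>+z. ennreal (dist (x i) (x j) + 2 * e) * indicator (A i \<times> A j) z \<partial>P)"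
    proof (intro nn_integral_mono)
      fix z
      show "ennreal (norm (fst z - snd z)) * indicator (A i \<times> A j) z
          \<le> ennreal (dist (x i) (x j) + 2 * e) * indicator (A i \<times> A j) z"
      proof (cases "z \<in> A i \<times> A j")
        case True
        then have "dist (fst z) (x i) \<le> e" "dist (snd z) (x j) \<le> e" using x ij by auto
        then have "dist (fst z) (snd z) \<le> dist (x i) (x j) + 2 * e"
          using dist_triangle[of "fst z" "snd z" "x i"] dist_triangle[of "x i" "snd z" "x j"]
          by (simp add: dist_commute)
        then show ?thesis using True by (simp add: dist_norm ennreal_leI)
      qed simp
    qed
    also have "\<dots> = ennreal (dist (x i) (x j) + 2 * e) * emeasure P (A i \<times> A j)"
      using rect ij by (simp add: nn_integral_cmult)
    also have "emeasure P (A i \<times> A j) = ennreal (?a i * ?b j)"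
      unfolding P_def using AM ij
      by (simp add: N.emeasure_pair_measure_Times M.emeasure_eq_measure N.emeasure_eq_measure ennreal_mult)
    finally have "ennreal (c i j) * (\<integral>\<^sup>+z. ennreal (norm (fst z - snd z)) * indicator (A i \<times> A j) z \<partial>P)
        \<le> ennreal (c i j) * (ennreal (dist (x i) (x j) + 2 * e) * ennreal (?a i * ?b j))"
      by (rule mult_left_mono) simp
    also have "\<dots> = ennreal (c i j * (?a i * ?b j) * (dist (x i) (x j) + 2 * e))"
    proof -
      have "ennreal r * (ennreal s * ennreal t) = ennreal (r * t * s)" if "0 \<le> r" "0 \<le> s" "0 \<le> t" for r s t
        using that by (simp add: ennreal_mult mult_ac)
      from this[OF c0[OF ij], of "dist (x i) (x j) + 2 * e" "?a i * ?b j"] show ?thesis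
        using e by (simp del: ennreal_plus)
    qed
    \<comment> \<open>The coefficient \<open>c i j * (?a i * ?b j)\<close> is \<open>p i j\<close>
      if both cells have mass, and 0 otherwise.\<close>
    also have "\<dots> \<le> ennreal (p i j * (dist (x i) (x j) + 2 * e))"
      using p[OF ij] e by (intro ennreal_leI mult_right_mono) (auto simp: c_def)
    finally show "ennreal (c i j) * (\<integral>\<^sup>+z. ennreal (norm (fst z - snd z)) * indicator (A i \<times> A j) z \<partial>P)
        \<le> ennreal (p i j * (dist (x i) (x j) + 2 * e))" .
  qed
  also have "\<dots> = ennreal (\<Sum>i\<in>I. \<Sum>j\<in>I. p i j * (dist (x i) (x j) + 2 * e))"
    using p e by (simp add: sum_nonneg)
  finally show ?thesis .
qed

section \<open>Discretised integrals and dual potentials\<close>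

lemma (in prob_space) integral_diff_le:
  fixes f g :: "'a \<Rightarrow> real"
  assumes "integrable M f" "integrable M g" "AE x in M. \<bar>f x - g x\<bar> \<le> e"
  shows "\<bar>(\<integral>x. f x \<partial>M) - (\<integral>x. g x \<partial>M)\<bar> \<le> e"
proof -
  have "\<bar>(\<integral>x. f x \<partial>M) - (\<integral>x. g x \<partial>M)\<bar> = \<bar>\<integral>x. f x - g x \<partial>M\<bar>"
    using assms by simp
  also have "\<dots> \<le> (\<integral>x. \<bar>f x - g x\<bar> \<partial>M)" by (rule integral_abs_bound)
  also have "\<dots> \<le> (\<integral>x. e \<partial>M)"
    using assms by (intro integral_mono_AE) auto
  also have "\<dots> = e" by (simp add: prob_space)
  finally show ?thesis .
qed

text \<open>The sum is the integral of the step function with value \<open>f (x i)\<close> on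
  \<open>A i\<close>. By disjointness exactly one term survives at a covered point, and there the
  Lipschitz bound gives an error of at most \<open>e\<close>.\<close>

lemma integral_partition_approx:
  fixes f :: "'a::metric_space \<Rightarrow> real"
  assumes "prob_space M" and f: "1-lipschitz_on UNIV f" "integrable M f"
    and A: "finite I" "A ` I \<subseteq> sets M" "disjoint_family_on A I"
    and cover: "AE z in M. z \<in> (\<Union>i\<in>I. A i)"
    and x: "\<And>i z. i \<in> I \<Longrightarrow> z \<in> A i \<Longrightarrow> dist z (x i) \<le> e"
  shows "\<bar>(\<integral>z. f z \<partial>M) - (\<Sum>i\<in>I. f (x i) * measure M (A i))\<bar> \<le> e"
proof -
  interpret prob_space M by fact
  let ?g = "\<lambda>z. \<Sum>i\<in>I. f (x i) * indicator (A i) z"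
  have A': "A i \<in> sets M" if "i \<in> I" for i using A that by auto
  have int: "integrable M (\<lambda>z. f (x i) * indicator (A i) z)" if "i \<in> I" for i
    using A'[OF that] by (simp add: emeasure_eq_measure)
  have "(\<integral>z. ?g z \<partial>M) = (\<Sum>i\<in>I. f (x i) * measure M (A i))"
    using int A' by (subst Bochner_Integration.integral_sum) auto
  moreover have "\<bar>(\<integral>z. f z \<partial>M) - (\<integral>z. ?g z \<partial>M)\<bar> \<le> e"
  proof (rule integral_diff_le[OF f(2)])
    show "AE z in M. \<bar>f z - ?g z\<bar> \<le> e"
      using cover
    proof eventually_elim
      case (elim z)
      then obtain i where i: "i \<in> I" "z \<in> A i" by blast
      then have "z \<notin> A j" if "j \<in> I" "j \<noteq> i" for j
        using A(3) that by (auto simp: disjoint_family_on_def)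
      then have "?g z = (\<Sum>j\<in>I. if j = i then f (x j) else 0)"
        using i by (intro sum.cong) (auto split: split_indicator)
      also have "\<dots> = f (x i)" using i A(1) by simp
      finally show ?case
        using lipschitz_onD[OF f(1), of z "x i"] x[OF i] by (simp add: dist_real_def)
    qed
  qed (use int in auto)
  ultimately show ?thesis by simp
qed

text \<open>Only the restriction to a ball carrying both measures matters, so a maximising sequence,
  normalised to vanish at the origin, is compact there by Arzela-Ascoli; the limit is extended to the
  whole space through the nearest-point projection.\<close>

lemma lipschitz_dual_maximizer:
  fixes M N :: "'a::euclidean_space measure"
  assumes M: "prob_space M" "sets M = sets borel" "AE x in M. norm x \<le> r"
    and N: "prob_space N" "sets N = sets borel" "AE x in N. norm x \<le> r"
  obtains f :: "'a \<Rightarrow> real" where "1-lipschitz_on UNIV f"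
    "\<And>g. 1-lipschitz_on UNIV g \<Longrightarrow>
       (\<integral>x. g x \<partial>N) - (\<integral>x. g x \<partial>M) \<le> (\<integral>x. f x \<partial>N) - (\<integral>x. f x \<partial>M)"
proof -
  interpret M: prob_space M by fact
  interpret N: prob_space N by fact
  note int = integrable_lipschitz[OF M] integrable_lipschitz[OF N]
  \<comment> \<open>A probability measure cannot live on the empty set; hence the ball is nonempty
    and the nearest-point projection onto it makes sense.\<close>
  have "\<exists>x::'a. norm x \<le> r"
  proof (rule ccontr)
    assume "\<nexists>x::'a. norm x \<le> r"
    then have "AE x in M. False" using M(3) by simp
    then show False by simp
  qed
  then have r: "0 \<le> r" by (meson norm_ge_zero order_trans)
  define \<Phi> where "\<Phi> g = (\<integral>x. g x \<partial>N) - (\<integral>x. g x \<partial>M)" for g :: "'a \<Rightarrow> real"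
  define Lip where "Lip = {g :: 'a \<Rightarrow> real. 1-lipschitz_on UNIV g}"
  \<comment> \<open>Each of the two integrals is within \<open>r\<close> of
    \<open>g 0\<close>.\<close>
  have bound: "\<Phi> g \<le> 2 * r" if "g \<in> Lip" for g
  proof -
    have g: "1-lipschitz_on UNIV g" using that by (simp add: Lip_def)
    have d: "\<bar>g x - g 0\<bar> \<le> r" if "norm x \<le> r" for x
      using lipschitz_onD[OF g, of x 0] that by (simp add: dist_real_def)
    have "\<bar>(\<integral>x. g x \<partial>N) - (\<integral>x. g 0 \<partial>N)\<bar> \<le> r"
      by (rule N.integral_diff_le) (use int(2)[OF g] N(3) d in auto)
    moreover have "\<bar>(\<integral>x. g x \<partial>M) - (\<integral>x. g 0 \<partial>M)\<bar> \<le> r"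
      by (rule M.integral_diff_le) (use int(1)[OF g] M(3) d in auto)
    ultimately show ?thesis by (simp add: \<Phi>_def M.prob_space N.prob_space)
  qed
  then have bdd: "bdd_above (\<Phi> ` Lip)" by (rule bdd_aboveI2)
  have "(\<lambda>_. 0) \<in> Lip" unfolding Lip_def by (auto intro: lipschitz_onI)
  then have ne: "Lip \<noteq> {}" by blast
  define S where "S = (SUP g\<in>Lip. \<Phi> g)"
  have "\<exists>g. g \<in> Lip \<and> S - 1 / Suc n < \<Phi> g" for n
    using less_cSUP_iff[OF ne bdd, of "S - 1 / Suc n"] by (auto simp: S_def)
  then obtain F where F: "\<And>n. F n \<in> Lip" "\<And>n. S - 1 / Suc n < \<Phi> (F n)" by metis
  define G where "G n x = F n x - F n 0" for n x
  have F_lip: "1-lipschitz_on UNIV (F n)" for n using F(1) by (simp add: Lip_def)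
  have G_lip: "1-lipschitz_on UNIV (G n)" for n
    using F_lip[of n] by (auto simp: lipschitz_on_def G_def dist_real_def)
  \<comment> \<open>Both measures have mass 1, so the subtracted constant cancels; the normalised
    functions are uniformly bounded by \<open>r\<close> on the ball.\<close>
  have \<Phi>G: "\<Phi> (G n) = \<Phi> (F n)" for n
    using int[OF F_lip[of n]] by (simp add: \<Phi>_def G_def M.prob_space N.prob_space)
  have G_le: "\<bar>G n x\<bar> \<le> norm x" for n x
    using abs_lipschitz_le[OF G_lip[of n], of x] by (simp add: G_def)
  obtain h :: "'a \<Rightarrow> real" and k :: "nat \<Rightarrow> nat" where k: "strict_mono k"
    and h: "\<And>e. 0 < e \<Longrightarrow> \<exists>m. \<forall>n x. m \<le> n \<and> x \<in> cball 0 r \<longrightarrow> norm (G (k n) x - h x) < e"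
  proof (rule Arzela_Ascoli[of "cball (0::'a) r" G r])
    show "\<exists>d>0. \<forall>n y. y \<in> cball 0 r \<and> norm (x - y) < d \<longrightarrow> norm (G n x - G n y) < e"
      if "0 < e" for x :: 'a and e :: real
    proof (intro exI[of _ e] conjI allI impI that)
      fix n y assume "y \<in> cball 0 r \<and> norm (x - y) < e"
      then show "norm (G n x - G n y) < e"
        using lipschitz_onD[OF G_lip, of x y n] by (simp add: dist_norm)
    qed
    show "norm (G n x) \<le> r" if "x \<in> cball 0 r" for n x
      using G_le[of n x] that by simp
  qed auto
  have lim: "(\<lambda>n. G (k n) x) \<longlonglongrightarrow> h x" if "x \<in> cball 0 r" for x
    unfolding LIMSEQ_iff using h that by blast
  define f where "f x = h (closest_point (cball 0 r) x)" for x
  have pr: "closest_point (cball 0 r) x \<in> cball 0 r" for x :: 'a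
    using r by (intro closest_point_in_set) auto
  have f_lip: "1-lipschitz_on UNIV f"
  proof (rule lipschitz_onI)
    fix x y :: 'a
    let ?p = "closest_point (cball 0 r)"
    have "(\<lambda>n. dist (G (k n) (?p x)) (G (k n) (?p y))) \<longlonglongrightarrow> dist (f x) (f y)"
      unfolding f_def by (intro tendsto_dist lim pr)
    moreover have "dist (G (k n) (?p x)) (G (k n) (?p y)) \<le> dist x y" for n
      using lipschitz_onD[OF G_lip, of "?p x" "?p y" "k n"] closest_point_lipschitz[of "cball (0::'a) r" x y] r
      by simp
    ultimately show "dist (f x) (f y) \<le> 1 * dist x y"
      by (auto intro: LIMSEQ_le_const2)
  qed simp
  have fh: "f x = h x" if "norm x \<le> r" for x
    using that by (simp add: f_def closest_point_self)
  \<comment> \<open>Stated for a generic measure on the ball, since it is applied to both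
    \<open>M\<close> and \<open>N\<close>; the constant \<open>r\<close> dominates.\<close>
  have conv: "(\<lambda>n. \<integral>x. G (k n) x \<partial>Q) \<longlonglongrightarrow> (\<integral>x. f x \<partial>Q)"
    if "prob_space Q" "sets Q = sets borel" "AE x in Q. norm x \<le> r" for Q
  proof (rule integral_dominated_convergence)
    interpret prob_space Q by fact
    show "f \<in> borel_measurable Q" "G (k n) \<in> borel_measurable Q" for n
      using integrable_lipschitz[OF that f_lip] integrable_lipschitz[OF that G_lip] by auto
    show "integrable Q (\<lambda>_. r)" by simp
    show "AE x in Q. (\<lambda>n. G (k n) x) \<longlonglongrightarrow> f x"
      using that(3) by eventually_elim (use lim fh in simp)
    show "AE x in Q. norm (G (k n) x) \<le> r" for n
      using that(3)
    proof eventually_elim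
      case (elim x)
      then show ?case using G_le[of "k n" x] by simp
    qed
  qed
  have lim\<Phi>: "(\<lambda>n. \<Phi> (G (k n))) \<longlonglongrightarrow> \<Phi> f"
    unfolding \<Phi>_def by (intro tendsto_diff conv M N)
  have limS: "(\<lambda>n. S - 1 / Suc (k n)) \<longlonglongrightarrow> S"
  proof -
    have "(\<lambda>n. S - 1 / real (Suc n)) \<longlonglongrightarrow> S - 0"
      by (intro tendsto_diff tendsto_const LIMSEQ_Suc lim_1_over_n)
    then show ?thesis using LIMSEQ_subseq_LIMSEQ[OF _ k, of "\<lambda>n. S - 1 / real (Suc n)" S] by (simp add: o_def)
  qed
  have "\<exists>m. \<forall>n\<ge>m. S - 1 / Suc (k n) \<le> \<Phi> (G (k n))"
    using F(2)[of "k _"] by (simp add: \<Phi>G less_imp_le)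
  then have "S \<le> \<Phi> f" by (rule LIMSEQ_le[OF limS lim\<Phi>])
  then have "\<Phi> g \<le> \<Phi> f" if "g \<in> Lip" for g
    using cSUP_upper[OF that bdd] by (simp add: S_def)
  then show thesis using that[of f] f_lip by (simp add: \<Phi>_def Lip_def)
qed

text \<open>Maximality of \<open>f\<close> bounds every discretised dual value, which yields a
  finite plan and so a coupling that is optimal up to \<open>\<epsilon>\<close>; testing with
  \<open>f\<close> itself gives the reverse inequality.\<close>

theorem kantorovich_rubinstein:
  fixes M N :: "'a::euclidean_space measure" and f :: "'a \<Rightarrow> real"
  assumes M: "prob_space M" "sets M = sets borel" "AE x in M. norm x \<le> r"
    and N: "prob_space N" "sets N = sets borel" "AE x in N. norm x \<le> r"
    and f: "1-lipschitz_on UNIV f"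
    and max: "\<And>g. 1-lipschitz_on UNIV g \<Longrightarrow>
       (\<integral>x. g x \<partial>N) - (\<integral>x. g x \<partial>M) \<le> (\<integral>x. f x \<partial>N) - (\<integral>x. f x \<partial>M)"
  shows "wasserstein1 M N = ennreal ((\<integral>x. f x \<partial>N) - (\<integral>x. f x \<partial>M))"
proof -
  interpret M: prob_space M by fact
  interpret N: prob_space N by fact
  note int = integrable_lipschitz[OF M] integrable_lipschitz[OF N]
  define D where "D = (\<integral>x. f x \<partial>N) - (\<integral>x. f x \<partial>M)"
  have "1-lipschitz_on UNIV (\<lambda>_::'a. 0::real)" by (auto intro: lipschitz_onI)
  from max[OF this] have D0: "0 \<le> D" by (simp add: D_def)
  have "wasserstein1 M N \<le> ennreal D"
  proof (rule ennreal_le_epsilon)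
    fix \<epsilon> :: real assume "0 < \<epsilon>"
    \<comment> \<open>Four errors of size \<open>e\<close> add up: one in the dual integral of each
      measure, and one at each endpoint of a transported pair.\<close>
    define e where "e = \<epsilon> / 4"
    have e: "0 < e" using \<open>0 < \<epsilon>\<close> by (simp add: e_def)
    have "compact (cball (0::'a) r)" by simp
    then have "\<forall>e>0. \<exists>C. finite C \<and> cball (0::'a) r \<subseteq> (\<Union>c\<in>C. ball c e)"
      unfolding compact_eq_totally_bounded by (rule conjunct2)
    then obtain C :: "'a set" where C: "finite C" "cball 0 r \<subseteq> (\<Union>c\<in>C. ball c e)"
      using e by meson
    obtain c and n :: nat where c: "C = c ` {i. i < n}"
      using finite_imp_nat_seg_image_inj_on[OF C(1)] by blast
    define I where "I = {0..<n}"
    \<comment> \<open>Each ball loses the earlier ones. The cells become disjoint and stay inside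
      their balls, so the distance to the centre is still at most \<open>e\<close>.\<close>
    define A where "A = disjointed (\<lambda>i. ball (c i) e)"
    have A: "finite I" "A ` I \<subseteq> sets borel" "disjoint_family_on A I"
      using disjoint_family_disjointed[of "\<lambda>i. ball (c i) e"]
      unfolding I_def A_def disjoint_family_on_def by (simp, force simp: disjointed_def, simp)
    have Ac: "dist z (c i) \<le> e" if "i \<in> I" "z \<in> A i" for i z
      using that disjointed_subset[of "\<lambda>i. ball (c i) e" i] by (auto simp: A_def dist_commute)
    have "(\<Union>i\<in>I. A i) = (\<Union>i\<in>{0..<n}. ball (c i) e)"
      unfolding A_def I_def by (rule finite_UN_disjointed_eq)
    also have "\<dots> = (\<Union>c\<in>C. ball c e)" by (auto simp: c)
    finally have "cball 0 r \<subseteq> (\<Union>i\<in>I. A i)" using C(2) by simp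
    then have in_cell: "z \<in> (\<Union>i\<in>I. A i)" if "norm z \<le> r" for z
      using that by (meson mem_cball_0 subsetD)
    have cover: "AE z in M. z \<in> (\<Union>i\<in>I. A i)" "AE z in N. z \<in> (\<Union>i\<in>I. A i)"
      using eventually_mono[OF M(3) in_cell] eventually_mono[OF N(3) in_cell] by simp_all
    have AM: "A ` I \<subseteq> sets M" "A ` I \<subseteq> sets N" using A(2) M(2) N(2) by auto
    have totM: "(\<Sum>i\<in>I. measure M (A i)) = 1"
    proof -
      have "(\<Sum>i\<in>I. measure M (A i)) = measure M (\<Union>i\<in>I. A i)"
        using A AM by (simp add: M.finite_measure_finite_Union)
      also have "\<dots> = 1" using cover AM A by (subst M.prob_eq_1) auto
      finally show ?thesis .
    qed
    have totN: "(\<Sum>i\<in>I. measure N (A i)) = 1"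
    proof -
      have "(\<Sum>i\<in>I. measure N (A i)) = measure N (\<Union>i\<in>I. A i)"
        using A AM by (simp add: N.finite_measure_finite_Union)
      also have "\<dots> = 1" using cover AM A by (subst N.prob_eq_1) auto
      finally show ?thesis .
    qed
    have "(\<Sum>i\<in>I. g (c i) * measure N (A i)) - (\<Sum>i\<in>I. g (c i) * measure M (A i)) \<le> D + 2 * e"
      if g: "1-lipschitz_on UNIV g" for g
      using integral_partition_approx[where x = c, OF M(1) g int(1)[OF g] A(1) AM(1) A(3) cover(1) Ac]
        integral_partition_approx[where x = c, OF N(1) g int(2)[OF g] A(1) AM(2) A(3) cover(2) Ac] max[OF g]
      by (simp add: D_def abs_le_iff)
    then obtain p :: "nat \<Rightarrow> nat \<Rightarrow> real" where p: "\<And>i j. i \<in> I \<Longrightarrow> j \<in> I \<Longrightarrow> 0 \<le> p i j"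
      "\<And>i. i \<in> I \<Longrightarrow> (\<Sum>j\<in>I. p i j) = measure M (A i)"
      "\<And>j. j \<in> I \<Longrightarrow> (\<Sum>i\<in>I. p i j) = measure N (A j)"
      "(\<Sum>i\<in>I. \<Sum>j\<in>I. p i j * dist (c i) (c j)) \<le> D + 2 * e"
      using finite_kantorovich_duality[OF A(1) _ totM _ totN, of c "D + 2 * e"] by auto
    \<comment> \<open>The plan has total mass 1, so the surcharge per pair of cells adds exactly
      \<open>2 * e\<close> in total.\<close>
    have "(\<Sum>i\<in>I. \<Sum>j\<in>I. p i j * (dist (c i) (c j) + 2 * e))
        = (\<Sum>i\<in>I. \<Sum>j\<in>I. p i j * dist (c i) (c j)) + (\<Sum>i\<in>I. \<Sum>j\<in>I. p i j) * (2 * e)"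
      by (simp add: distrib_left sum.distrib sum_distrib_right)
    also have "(\<Sum>i\<in>I. \<Sum>j\<in>I. p i j) = 1" using p(2) totM by simp
    finally have "(\<Sum>i\<in>I. \<Sum>j\<in>I. p i j * (dist (c i) (c j) + 2 * e)) \<le> D + \<epsilon>"
      using p(4) by (simp add: e_def)
    then have "ennreal (\<Sum>i\<in>I. \<Sum>j\<in>I. p i j * (dist (c i) (c j) + 2 * e)) \<le> ennreal (D + \<epsilon>)"
      by (rule ennreal_leI)
    with wasserstein1_le_partition_plan[OF M(1) N(1) M(2) N(2) A totM totN p(1-3) Ac less_imp_le[OF e]]
    have "wasserstein1 M N \<le> ennreal (D + \<epsilon>)"
      by (rule order_trans)
    then show "wasserstein1 M N \<le> ennreal D + ennreal \<epsilon>"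
      using D0 \<open>0 < \<epsilon>\<close> by simp
  qed
  moreover have "ennreal D \<le> wasserstein1 M N"
    unfolding D_def by (rule lipschitz_le_wasserstein1[OF f int[OF f]])
  ultimately show ?thesis
    by (simp add: D_def)
qed

section \<open>The two learning problems\<close>

lemma AE_norm_le_of_compact_support:
  fixes M :: "'a::{real_normed_vector, second_countable_topology} measure"
  assumes "sets M = sets borel" "measure_support M \<subseteq> C" "compact C"
  obtains r where "AE x in M. norm x \<le> r"
proof -
  obtain r where "\<And>x. x \<in> C \<Longrightarrow> norm x \<le> r"
    using compact_imp_bounded[OF assms(3)] by (auto simp: bounded_iff)
  then have "AE x in M. norm x \<le> r"
    using AE_measure_support[OF assms(1)] assms(2) by (auto elim!: eventually_mono)
  then show thesis by (rule that)
qed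

lemma sup_norm_le_bound:
  assumes "(SUP \<phi>\<in>K. sup_norm (G \<phi>)) < \<infinity>"
  obtains B where "\<And>\<phi> y. \<phi> \<in> K \<Longrightarrow> norm (G \<phi> y) \<le> B"
proof -
  obtain B where B: "0 \<le> B" "(SUP \<phi>\<in>K. sup_norm (G \<phi>)) = ennreal B"
    using assms by (cases "SUP \<phi>\<in>K. sup_norm (G \<phi>)") auto
  have "norm (G \<phi> y) \<le> B" if "\<phi> \<in> K" for \<phi> y
  proof -
    have "ennreal (norm (G \<phi> y)) \<le> sup_norm (G \<phi>)"
      unfolding sup_norm_def by (rule SUP_upper) simp
    also have "\<dots> \<le> (SUP \<phi>\<in>K. sup_norm (G \<phi>))"
      using that by (rule SUP_upper)
    finally show ?thesis using B by (simp add: ennreal_le_iff)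
  qed
  then show thesis by (rule that)
qed

text \<open>The data term does not depend on the regulariser and \<open>lam\<close> is positive, so
  maximising \<open>J1\<close> amounts to maximising the difference of expectations.\<close>

lemma sup_J1_eq_of_maximizer:
  assumes "0 < lam" "R \<in> Lip1"
    and "\<And>S. S \<in> Lip1 \<Longrightarrow>
      (\<integral>y. S (g y) \<partial>piy) - (\<integral>x. S x \<partial>pix) \<le> (\<integral>y. R (g y) \<partial>piy) - (\<integral>x. R x \<partial>pix)"
  shows "sup_J1 A pix g lam piy = ereal (J1 A pix g R lam piy)"
  unfolding sup_J1_def
proof (rule antisym)
  show "(SUP S\<in>Lip1. ereal (J1 A pix g S lam piy)) \<le> ereal (J1 A pix g R lam piy)"
    using assms by (intro SUP_least) (simp add: J1_def mult_left_mono)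
qed (use assms in \<open>auto intro: SUP_upper\<close>)

text \<open>Duality is applied to \<open>pix\<close> and the push-forward of \<open>piy\<close> by
  \<open>g\<close>; both live on the ball of radius \<open>max r B\<close>.\<close>

lemma exists_maximizer_sup_J1_eq_J2:
  fixes pix :: "(real ^ 'n) measure" and piy :: "(real ^ 'k) measure"
  assumes pix: "prob_space pix" "sets pix = sets borel" "AE x in pix. norm x \<le> r"
    and piy: "prob_space piy" "sets piy = sets borel"
    and g: "g \<in> borel_measurable borel" "\<And>y. norm (g y) \<le> B"
    and lam: "0 < lam"
  shows "\<exists>R\<in>Lip1. ereal (J1 A pix g R lam piy) = sup_J1 A pix g lam piy"
    and "sup_J1 A pix g lam piy = J2 A pix g lam piy"
proof -
  define \<rho> where "\<rho> = max r B"
  define N where "N = distr piy borel g"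
  have g': "g \<in> piy \<rightarrow>\<^sub>M borel" using g(1) piy(2) by (simp cong: measurable_cong_sets)
  have M: "prob_space pix" "sets pix = sets borel" "AE x in pix. norm x \<le> \<rho>"
    using pix by (auto simp: \<rho>_def elim!: eventually_mono)
  have ball: "{x \<in> space borel. norm x \<le> \<rho>} \<in> sets (borel :: (real ^ 'n) measure)"
    by measurable
  have "norm (g y) \<le> \<rho>" for y using g(2)[of y] by (simp add: \<rho>_def)
  then have "AE x in N. norm x \<le> \<rho>"
    unfolding N_def AE_distr_iff[OF g' ball] by (intro AE_I2)
  then have N: "prob_space N" "sets N = sets borel" "AE x in N. norm x \<le> \<rho>"
    using prob_space.prob_space_distr[OF piy(1) g'] by (simp_all add: N_def)
  obtain R :: "real ^ 'n \<Rightarrow> real" where R: "1-lipschitz_on UNIV R"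
    and max: "\<And>S. 1-lipschitz_on UNIV S \<Longrightarrow>
       (\<integral>x. S x \<partial>N) - (\<integral>x. S x \<partial>pix) \<le> (\<integral>x. R x \<partial>N) - (\<integral>x. R x \<partial>pix)"
    using lipschitz_dual_maximizer[OF M N] by blast
  have N_int: "(\<integral>x. S x \<partial>N) = (\<integral>y. S (g y) \<partial>piy)" if "1-lipschitz_on UNIV S" for S :: "real ^ 'n \<Rightarrow> real"
    unfolding N_def using g' borel_measurable_lipschitz[OF that] by (rule integral_distr)
  have "sup_J1 A pix g lam piy = ereal (J1 A pix g R lam piy)"
    using lam R max by (intro sup_J1_eq_of_maximizer) (auto simp: Lip1_def N_int)
  moreover have "J2 A pix g lam piy = ereal (J1 A pix g R lam piy)"
  proof -
    \<comment> \<open>The zero function competes, so the maximum is nonnegative and survives the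
      passage through \<open>ennreal\<close> unchanged.\<close>
    have "1-lipschitz_on UNIV (\<lambda>_::real ^ 'n. 0::real)" by (auto intro: lipschitz_onI)
    from max[OF this] have "0 \<le> (\<integral>x. R x \<partial>N) - (\<integral>x. R x \<partial>pix)" by simp
    then have "enn2ereal (wasserstein1 pix N) = ereal ((\<integral>x. R x \<partial>N) - (\<integral>x. R x \<partial>pix))"
      using kantorovich_rubinstein[OF M N R max] by (simp add: enn2ereal_ennreal)
    then show ?thesis by (simp add: J2_def J1_def N_def[symmetric] N_int[OF R])
  qed
  ultimately show "\<exists>R\<in>Lip1. ereal (J1 A pix g R lam piy) = sup_J1 A pix g lam piy"
    and "sup_J1 A pix g lam piy = J2 A pix g lam piy"
    using R by (auto simp: Lip1_def)
qed

section \<open>Continuity in the parameter and the direct method\<close>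

text \<open>Pointwise convergence suffices for a fixed \<open>R\<close>: the common bound
  \<open>B\<close> supplies constant dominating functions, integrable for a probability
  measure.\<close>

lemma tendsto_J1:
  fixes A :: "real ^ 'n \<Rightarrow> real ^ 'k" and piy :: "(real ^ 'k) measure"
  assumes "linear A"
    and piy: "prob_space piy" "sets piy = sets borel" "AE y in piy. norm y \<le> r"
    and meas: "\<And>m. gs m \<in> borel_measurable borel" "g \<in> borel_measurable borel"
    and bound: "\<And>m y. norm (gs m y) \<le> B"
    and lim: "\<And>y. (\<lambda>m. gs m y) \<longlonglongrightarrow> g y"
    and R: "R \<in> Lip1"
  shows "(\<lambda>m. J1 A pix (gs m) R lam piy) \<longlonglongrightarrow> J1 A pix g R lam piy"
proof -
  interpret prob_space piy by fact
  have meas': "gs m \<in> borel_measurable piy" "g \<in> borel_measurable piy" for m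
    using meas piy(2) by (simp_all cong: measurable_cong_sets)
  have id: "(\<lambda>y. y) \<in> borel_measurable piy"
    using piy(2) by (simp cong: measurable_cong_sets)
  have Acont: "continuous_on UNIV A"
    using assms(1) by (intro linear_continuous_on) (simp add: linear_conv_bounded_linear)
  then have A_meas: "A \<in> borel_measurable borel" by (rule borel_measurable_continuous_onI)
  note A_comp = measurable_compose[OF _ A_meas]
  have R': "1-lipschitz_on UNIV R" using R by (simp add: Lip1_def)
  have Rcont: "continuous_on UNIV R" by (rule lipschitz_on_continuous_on[OF R'])
  note R_comp = measurable_compose[OF _ borel_measurable_lipschitz[OF R']]
  obtain L where L: "0 < L" "\<And>x. norm (A x) \<le> L * norm x"
    using linear_bounded_pos[OF assms(1)] by blast
  have "(\<lambda>m. \<integral>y. (norm (y - A (gs m y)))\<^sup>2 \<partial>piy) \<longlonglongrightarrow> (\<integral>y. (norm (y - A (g y)))\<^sup>2 \<partial>piy)"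
  proof (rule integral_dominated_convergence)
    show "(\<lambda>y. (norm (y - A (g y)))\<^sup>2) \<in> borel_measurable piy"
      "(\<lambda>y. (norm (y - A (gs m y)))\<^sup>2) \<in> borel_measurable piy" for m
      using id A_comp[OF meas'(2)] A_comp[OF meas'(1)] by measurable
    \<comment> \<open>Here \<open>r\<close> bounds the data almost everywhere and
      \<open>L * B\<close> bounds the image of the reconstructions under \<open>A\<close>.\<close>
    show "integrable piy (\<lambda>_. (r + L * B)\<^sup>2)" by simp
    have "(\<lambda>m. A (gs m y)) \<longlonglongrightarrow> A (g y)" for y
      using Acont lim by (rule continuous_on_tendsto_compose) auto
    then show "AE y in piy. (\<lambda>m. (norm (y - A (gs m y)))\<^sup>2) \<longlonglongrightarrow> (norm (y - A (g y)))\<^sup>2"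
      by (intro AE_I2 tendsto_intros)
    show "AE y in piy. norm ((norm (y - A (gs m y)))\<^sup>2) \<le> (r + L * B)\<^sup>2" for m
      using piy(3)
    proof eventually_elim
      case (elim y)
      have "norm (A (gs m y)) \<le> L * B"
        using L(2)[of "gs m y"] mult_left_mono[OF bound[of m y] less_imp_le[OF L(1)]] by linarith
      then have "norm (y - A (gs m y)) \<le> r + L * B"
        using elim norm_triangle_ineq4[of y "A (gs m y)"] by linarith
      then show ?case by (simp add: power_mono)
    qed
  qed
  moreover have "(\<lambda>m. \<integral>y. R (gs m y) \<partial>piy) \<longlonglongrightarrow> (\<integral>y. R (g y) \<partial>piy)"
  proof (rule integral_dominated_convergence)
    show "(\<lambda>y. R (g y)) \<in> borel_measurable piy" "(\<lambda>y. R (gs m y)) \<in> borel_measurable piy" for m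
      using R_comp meas' by auto
    show "integrable piy (\<lambda>_. \<bar>R 0\<bar> + B)" by simp
    have "(\<lambda>m. R (gs m y)) \<longlonglongrightarrow> R (g y)" for y
      using Rcont lim by (rule continuous_on_tendsto_compose) auto
    then show "AE y in piy. (\<lambda>m. R (gs m y)) \<longlonglongrightarrow> R (g y)" by simp
    have "norm (R (gs m y)) \<le> \<bar>R 0\<bar> + B" for m y
      using abs_lipschitz_le[OF R', of "gs m y"] bound[of m y] by simp
    then show "AE y in piy. norm (R (gs m y)) \<le> \<bar>R 0\<bar> + B" for m by simp
  qed
  ultimately show ?thesis
    unfolding J1_def by (intro tendsto_intros)
qed

theorem theorem1:
  fixes A :: "real ^ 'n \<Rightarrow> real ^ 'k"
    and pix :: "(real ^ 'n) measure"
    and piy :: "real \<Rightarrow> (real ^ 'k) measure"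
    and G :: "'p::euclidean_space \<Rightarrow> real ^ 'k \<Rightarrow> real ^ 'n"
    and K :: "'p set"
    and Ky :: "(real ^ 'k) set"
    and \<delta> lam :: real
  assumes "linear A"
    and "prob_space pix" and "sets pix = sets borel"
    and "\<And>d. d \<ge> 0 \<Longrightarrow> prob_space (piy d)"
    and "\<And>d. d \<ge> 0 \<Longrightarrow> sets (piy d) = sets borel"
    and "\<And>\<phi>. \<phi> \<in> K \<Longrightarrow> G \<phi> \<in> borel_measurable borel"
    and A1x: "compact (measure_support pix)"
    and A1y: "compact Ky" "\<And>d. d \<ge> 0 \<Longrightarrow> measure_support (piy d) \<subseteq> Ky"
    and A2: "compact K" "K \<noteq> {}"
    and A3: "\<And>\<phi>s \<phi> y. (\<forall>m. \<phi>s m \<in> K) \<Longrightarrow> \<phi> \<in> K \<Longrightarrow> \<phi>s \<longlonglongrightarrow> \<phi> \<Longrightarrow>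
               (\<lambda>m. G (\<phi>s m) y) \<longlonglongrightarrow> G \<phi> y"
    and A4: "(SUP \<phi>\<in>K. sup_norm (G \<phi>)) < \<infinity>"
    and "\<delta> \<ge> 0" and "lam > 0"
  shows "(\<exists>\<phi> R. optimal_P1 A pix G K lam (piy \<delta>) \<phi> R) \<and>
         (\<exists>\<phi>. optimal_P2 A pix G K lam (piy \<delta>) \<phi>) \<and>
         (INF \<phi>\<in>K. SUP R\<in>Lip1. ereal (J1 A pix (G \<phi>) R lam (piy \<delta>))) =
           (INF \<phi>\<in>K. J2 A pix (G \<phi>) lam (piy \<delta>)) \<and>
         (\<forall>\<phi> R. optimal_P1 A pix G K lam (piy \<delta>) \<phi> R \<longrightarrow>
                 optimal_P2 A pix G K lam (piy \<delta>) \<phi>) \<and>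
         (\<forall>\<phi>. optimal_P2 A pix G K lam (piy \<delta>) \<phi> \<longrightarrow>
            (\<forall>R. is_arg_max (\<lambda>R. (\<integral>y. R (G \<phi> y) \<partial>piy \<delta>) - (\<integral>x. R x \<partial>pix)) (\<lambda>R. R \<in> Lip1) R \<longrightarrow>
                 optimal_P1 A pix G K lam (piy \<delta>) \<phi> R))"
proof -
  let ?F = "\<lambda>\<phi>. sup_J1 A pix (G \<phi>) lam (piy \<delta>)"
  have piy: "prob_space (piy \<delta>)" "sets (piy \<delta>) = sets borel"
    using assms(4,5) \<open>\<delta> \<ge> 0\<close> by auto
  obtain rx where rx: "AE x in pix. norm x \<le> rx"
    using AE_norm_le_of_compact_support[OF assms(3) order_refl A1x] .
  obtain ry where ry: "AE y in piy \<delta>. norm y \<le> ry"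
    using AE_norm_le_of_compact_support[OF piy(2) A1y(2)[OF \<open>\<delta> \<ge> 0\<close>] A1y(1)] .
  obtain B where B: "\<And>\<phi> y. \<phi> \<in> K \<Longrightarrow> norm (G \<phi> y) \<le> B"
    using sup_norm_le_bound[OF A4] by blast
  note duality = exists_maximizer_sup_J1_eq_J2[OF assms(2,3) rx piy assms(6) B \<open>lam > 0\<close>]
  have eq: "?F \<phi> = J2 A pix (G \<phi>) lam (piy \<delta>)" if "\<phi> \<in> K" for \<phi>
    using duality(2) that by blast
  have inf_eq: "(INF \<phi>\<in>K. ?F \<phi>) = (INF \<phi>\<in>K. J2 A pix (G \<phi>) lam (piy \<delta>))"
    using eq by (intro INF_cong) auto
  have min: "\<exists>\<phi>\<in>K. ?F \<phi> = (INF \<psi>\<in>K. ?F \<psi>)"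
  proof -
    \<comment> \<open>Direct method: a minimising sequence of values comes from parameters in
      \<open>K\<close>, which accumulate at some \<open>\<phi>\<close> by compactness.\<close>
    obtain v where v: "range v \<subseteq> ?F ` K" "v \<longlonglongrightarrow> Inf (?F ` K)"
      using Inf_as_limit[of "?F ` K"] A2(2) by auto
    then have "\<forall>n. \<exists>\<psi>\<in>K. v n = ?F \<psi>" by blast
    then obtain \<psi> where \<psi>: "\<And>n. \<psi> n \<in> K" "\<And>n. v n = ?F (\<psi> n)" by metis
    obtain \<phi> k where k: "\<phi> \<in> K" "strict_mono k" "(\<psi> \<circ> k) \<longlonglongrightarrow> \<phi>"
      using A2(1) \<psi>(1) unfolding compact_def by blast
    \<comment> \<open>With \<open>R\<close> fixed, \<open>J1\<close> stays below the supremum along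
      the sequence, so its limit is at most the infimum. Taking the supremum over \<open>R\<close>
      only afterwards gives lower semicontinuity without any uniformity in \<open>R\<close>.\<close>
    have "ereal (J1 A pix (G \<phi>) R lam (piy \<delta>)) \<le> (INF \<psi>\<in>K. ?F \<psi>)" if R: "R \<in> Lip1" for R
    proof (rule LIMSEQ_le)
      have "(\<lambda>m. J1 A pix (G (\<psi> (k m))) R lam (piy \<delta>)) \<longlonglongrightarrow> J1 A pix (G \<phi>) R lam (piy \<delta>)"
        using \<psi>(1) k A3[of "\<psi> \<circ> k" \<phi>]
        by (intro tendsto_J1[where B = B, OF assms(1) piy ry _ _ _ _ R] assms(6) B) (auto simp: o_def)
      then show "(\<lambda>m. ereal (J1 A pix (G (\<psi> (k m))) R lam (piy \<delta>))) \<longlonglongrightarrow> ereal (J1 A pix (G \<phi>) R lam (piy \<delta>))"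
        by (rule tendsto_ereal)
      show "(v \<circ> k) \<longlonglongrightarrow> (INF \<psi>\<in>K. ?F \<psi>)"
        using v(2) k(2) by (rule LIMSEQ_subseq_LIMSEQ)
      show "\<exists>m. \<forall>n\<ge>m. ereal (J1 A pix (G (\<psi> (k n))) R lam (piy \<delta>)) \<le> (v \<circ> k) n"
        using R by (auto simp: \<psi>(2) sup_J1_def intro: SUP_upper)
    qed
    then have "?F \<phi> \<le> (INF \<psi>\<in>K. ?F \<psi>)"
      unfolding sup_J1_def[of A pix "G \<phi>"] by (rule SUP_least)
    then show ?thesis using k(1) by (auto intro: antisym INF_lower)
  qed
  then obtain \<phi> where \<phi>: "\<phi> \<in> K" "?F \<phi> = (INF \<psi>\<in>K. ?F \<psi>)" by blast
  obtain R where "R \<in> Lip1" "ereal (J1 A pix (G \<phi>) R lam (piy \<delta>)) = ?F \<phi>"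
    \<comment> \<open>Membership in \<open>K\<close> is used twice, for the measurability and for
      the bound of \<open>G \<phi>\<close>.\<close>
    using duality(1)[OF \<phi>(1) \<phi>(1)] by blast
  then have P1: "optimal_P1 A pix G K lam (piy \<delta>) \<phi> R"
    using \<phi> by (simp add: optimal_P1_def)
  \<comment> \<open>The two objectives coincide on \<open>K\<close>, so they have the same
    minimisers; only the inner maximiser distinguishes the notions of optimality.\<close>
  have P1_P2: "optimal_P2 A pix G K lam (piy \<delta>) \<phi>" if "optimal_P1 A pix G K lam (piy \<delta>) \<phi> R" for \<phi> R
    using that eq inf_eq by (auto simp: optimal_P1_def optimal_P2_def)
  have P2_P1: "optimal_P1 A pix G K lam (piy \<delta>) \<phi> R"
    if P2: "optimal_P2 A pix G K lam (piy \<delta>) \<phi>"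
      and R: "is_arg_max (\<lambda>R. (\<integral>y. R (G \<phi> y) \<partial>piy \<delta>) - (\<integral>x. R x \<partial>pix)) (\<lambda>R. R \<in> Lip1) R" for \<phi> R
  proof -
    \<comment> \<open>Being an arg max of the difference of expectations is exactly what makes
      \<open>R\<close> attain the inner supremum at \<open>\<phi>\<close>.\<close>
    have "R \<in> Lip1" "?F \<phi> = ereal (J1 A pix (G \<phi>) R lam (piy \<delta>))"
      using R \<open>lam > 0\<close> by (auto simp: is_arg_max_linorder intro: sup_J1_eq_of_maximizer)
    then show ?thesis
      using P2 eq inf_eq by (auto simp: optimal_P1_def optimal_P2_def)
  qed
  show ?thesis
    using P1 P1_P2[OF P1] inf_eq P1_P2 P2_P1 by (auto simp: sup_J1_def)
qed

end
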